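(* Let $(\varphi_\ell)_{\ell\ge1}$ be polynomial functions $\mathbb{R}\to\mathbb{R}$, $(N_\ell)_{\ell\ge0}$ positive integers, $W_\ell\in\mathbb{R}^{N_{\ell+1}\times N_\ell}$ matrices, and define $\Phi_0(\mathbf{x})=W_0\mathbf{x}$, $\Phi_{\ell+1}(\mathbf{x})=W_{\ell+1}\varphi_{\ell+1}(\Phi_\ell(\mathbf{x}))$ with $\varphi_{\ell+1}$ applied entrywise. Then for any $\mathbf{x}\in\mathbb{R}^{N_0}$ and any $\ell\ge0$, $$\Phi_\ell(\mathbf{x})=\sum_{\tau\in\mathbb{T}_\ell}\frac{\varphi_\tau}{s(\tau)}\,\mathbf{x}_\tau\,\mathbf{W}_\tau=\sum_{\eta\in\mathbb{T}_\ell(\mathbf{x})}\frac{\varphi_\eta}{s(\eta)}\,\mathbf{W}_\eta\ \in\mathbb{R}^{N_{\ell+1}}.$$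
   Context: Trees. $\mathbb{T}_0=\{[\bullet_{\mathbf{e}_1}]_0,\dots,[\bullet_{\mathbf{e}_{N_0}}]_0\}$ is a set of $N_0$ distinct symbols (trees consisting of a root edge labelled $W_0$ with a leaf labelled by the basis vector $\mathbf{e}_i\in\mathbb{R}^{N_0}$), and $$\mathbb{T}_{\ell+1}=\{[\tau_1\cdots\tau_M]_{\ell+1}: M\ge0,\ \tau_1,\dots,\tau_M\in\mathbb{T}_\ell\},$$ where $[\tau_1\cdots\tau_M]_{\ell+1}$ is the rooted non-plane tree obtained by joining $\tau_1,\dots,\tau_M$ at their roots and grafting the result on a new root edge labelled $W_{\ell+1}$; the order of $\tau_1,\dots,\tau_M$ is irrelevant, so $\mathbb{T}_{\ell+1}$ is in bijection with finite multisets of elements of $\mathbb{T}_\ell$. $\mathbb{T}_\ell(\mathbf{x})$ is the set of trees obtained from those in $\mathbb{T}_\ell$ by replacing every leaf label $\mathbf{e}_i$ by $\mathbf{x}$: $\mathbb{T}_0(\mathbf{x})=\{[\bullet_{\mathbf{x}}]_0\}$ and $\mathbb{T}_{\ell+1}(\mathbf{x})$ is built from $\mathbb{T}_\ell(\mathbf{x})$ by the same bracket operation. The associated vectors and coefficients are defined recursively (for both kinds of trees where applicable; $\odot$ is the entrywise product, empty entrywise products are the all-ones vector, empty scalar products are $1$): - $\mathbf{W}_{[\bullet_{\mathbf{e}_i}]_0}=W_0\mathbf{e}_i$, $\mathbf{W}_{[\bullet_{\mathbf{x}}]_0}=W_0\mathbf{x}$, $\mathbf{W}_{[\tau_1\cdots\tau_M]_{\ell+1}}=W_{\ell+1}\big(\mathbf{W}_{\tau_1}\odot\cdots\odot\mathbf{W}_{\tau_M}\big)\in\mathbb{R}^{N_{\ell+2}}$;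 - $s([\bullet_{\mathbf{e}_i}]_0)=s([\bullet_{\mathbf{x}}]_0)=1$, $s([(\tau_1)^{k_1}\cdots(\tau_m)^{k_m}]_\ell)=\prod_i k_i!\,s(\tau_i)^{k_i}$ for distinct $\tau_1,\dots,\tau_m$ repeated $k_1,\dots,k_m$ times; - $\mathbf{x}_{[\bullet_{\mathbf{e}_i}]_0}=[\mathbf{x}]_i$, $\mathbf{x}_{[\tau_1\cdots\tau_M]_\ell}=\prod_{i=1}^M\mathbf{x}_{\tau_i}\in\mathbb{R}$; - $\varphi_{[\bullet_{\mathbf{e}_i}]_0}=\varphi_{[\bullet_{\mathbf{x}}]_0}=1$, $\varphi_{[\tau_1\cdots\tau_M]_{\ell+1}}=\varphi_{\ell+1}^{(M)}(0)\prod_{i=1}^M\varphi_{\tau_i}$, with $\varphi^{(M)}$ the $M$-th derivative. Only finitely many $\varphi_\tau$ are nonzero since the $\varphi_\ell$ are polynomials, so the sums are finite. *)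

theory Defs
  imports "HOL-Analysis.Analysis" "HOL-Library.Multiset" "Jordan_Normal_Form.Matrix"
begin

unbundle no vec_syntax

text \<open>
  Rooted non-plane trees with labelled edges. \<open>Leaf a\<close> is a root edge labelled \<open>W\<^sub>0\<close> carrying a
  leaf with label \<open>a\<close>; \<open>Node k ts\<close> joins the trees in the multiset \<open>ts\<close> at their roots and grafts
  the result on a root edge labelled \<open>W\<^sub>k\<close>. The label \<open>k\<close> is kept explicitly since it is not
  determined by the shape, because \<open>ts\<close> may be empty.
\<close>

datatype 'a tree = Leaf 'a | Node nat "'a tree multiset"

text \<open>
  The set \<open>trees {..<N 0} l\<close> is the set of trees of level \<open>l\<close> whose leaves carry the basis vectors of
  \<open>\<real>\<^bsup>N 0\<^esup>\<close>, the \<open>i\<close>-th basis vector (counted from 0) being represented by its index \<open>i\<close>.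
  The set \<open>trees {x} l\<close> consists of the trees of level \<open>l\<close> all of whose leaves carry the
  vector \<open>x\<close>.
\<close>

primrec trees :: "'a set \<Rightarrow> nat \<Rightarrow> 'a tree set" where
  "trees A 0 = Leaf ` A"
| "trees A (Suc l) = {Node (Suc l) ts | ts. set_mset ts \<subseteq> trees A l}"

lemma map_tree_trees: "map_tree f ` trees A l = trees (f ` A) l"
proof (induction l)
  case 0
  show ?case by (auto simp: image_image)
next
  case (Suc l)
  show ?case
  proof (intro equalityI subsetI)
    fix t assume "t \<in> map_tree f ` trees A (Suc l)"
    then obtain ts where ts: "set_mset ts \<subseteq> trees A l" and t: "t = map_tree f (Node (Suc l) ts)"
      by auto
    have "set_mset (image_mset (map_tree f) ts) \<subseteq> trees (f ` A) l"
      unfolding Suc.IH[symmetric] using ts by auto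
    then show "t \<in> trees (f ` A) (Suc l)" using t by auto
  next
    fix t assume "t \<in> trees (f ` A) (Suc l)"
    then obtain us where us: "set_mset us \<subseteq> map_tree f ` trees A l" and t: "t = Node (Suc l) us"
      unfolding Suc.IH by auto
    have g: "inv_into (trees A l) (map_tree f) u \<in> trees A l
        \<and> map_tree f (inv_into (trees A l) (map_tree f) u) = u" if "u \<in># us" for u
      using us that by (meson f_inv_into_f inv_into_into subsetD)
    define ts where "ts = image_mset (inv_into (trees A l) (map_tree f)) us"
    have "set_mset ts \<subseteq> trees A l" using g by (auto simp: ts_def)
    moreover have "image_mset (map_tree f) ts = us"
    proof -
      have "image_mset (map_tree f) ts
          = image_mset (\<lambda>u. map_tree f (inv_into (trees A l) (map_tree f) u)) us"
        by (simp add: ts_def multiset.map_comp comp_def)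
      also have "\<dots> = image_mset (\<lambda>u. u) us"
        using g by (intro image_mset_cong) blast
      finally show ?thesis by simp
    qed
    ultimately show "t \<in> map_tree f ` trees A (Suc l)"
      using t by (auto intro!: image_eqI[of _ _ "Node (Suc l) ts"])
  qed
qed

text \<open>Replacing every basis vector in the leaves by \<open>x\<close> yields exactly the second kind of trees.\<close>

lemma trees_substitute:
  assumes "N0 > 0"
  shows "map_tree (\<lambda>_. x) ` trees {..<N0} l = trees {x} l"
proof -
  have "(\<lambda>_. x) ` {..<N0} = {x}" using assms by auto
  then show ?thesis by (simp add: map_tree_trees)
qed

definition hadamard_prod :: "nat \<Rightarrow> real vec multiset \<Rightarrow> real vec" where
  "hadamard_prod n vs = vec n (\<lambda>i. \<Prod>v\<in>#vs. v $ i)"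

text \<open>The argument \<open>e\<close> sends a leaf label to the vector it stands for.\<close>

primrec tree_vec ::
  "(nat \<Rightarrow> nat) \<Rightarrow> (nat \<Rightarrow> real mat) \<Rightarrow> ('a \<Rightarrow> real vec) \<Rightarrow> 'a tree \<Rightarrow> real vec" where
  "tree_vec N W e (Leaf a) = W 0 *\<^sub>v e a"
| "tree_vec N W e (Node k ts) = W k *\<^sub>v hadamard_prod (N k) (image_mset (tree_vec N W e) ts)"

function tree_sym :: "'a tree \<Rightarrow> nat" where
  "tree_sym (Leaf a) = 1"
| "tree_sym (Node k ts) = (\<Prod>t\<in>set_mset ts. fact (count ts t) * tree_sym t ^ count ts t)"
  by pat_completeness auto
termination
proof (relation "Wellfounded.measure size", goal_cases)
  case (2 k ts t)
  then obtain us where "ts = add_mset t us" by (metis multi_member_split)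
  then show ?case by simp
qed simp

primrec tree_mono :: "real vec \<Rightarrow> nat tree \<Rightarrow> real" where
  "tree_mono x (Leaf i) = x $ i"
| "tree_mono x (Node k ts) = (\<Prod>t\<in>#ts. tree_mono x t)"

primrec tree_coeff :: "(nat \<Rightarrow> real \<Rightarrow> real) \<Rightarrow> 'a tree \<Rightarrow> real" where
  "tree_coeff \<phi> (Leaf a) = 1"
| "tree_coeff \<phi> (Node k ts) =
     (deriv ^^ size ts) (\<phi> k) 0 * (\<Prod>t\<in>#ts. tree_coeff \<phi> t)"

primrec network :: "(nat \<Rightarrow> real mat) \<Rightarrow> (nat \<Rightarrow> real \<Rightarrow> real) \<Rightarrow> nat \<Rightarrow> real vec \<Rightarrow> real vec" where
  "network W \<phi> 0 x = W 0 *\<^sub>v x"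
| "network W \<phi> (Suc l) x = W (Suc l) *\<^sub>v map_vec (\<phi> (Suc l)) (network W \<phi> l x)"

text \<open>
  Sum in \<open>\<real>\<^bsup>n\<^esup>\<close> of a family over a possibly infinite set, only finitely many of whose members are
  nonzero. (Like \<open>sum\<close>, \<open>finsum_vec\<close> is the zero vector on infinite sets, hence the restriction to
  the support.)
\<close>

definition fin_supp_sum_vec :: "nat \<Rightarrow> ('b \<Rightarrow> real vec) \<Rightarrow> 'b set \<Rightarrow> real vec" where
  "fin_supp_sum_vec n f A = finsum_vec TYPE(real) n f {a \<in> A. f a \<noteq> 0\<^sub>v n}"

end

theory Submission
  imports Defs
begin

text \<open>
  Induction on the level, one component at a time. By Taylor's formula at 0 and the multinomial
  theorem, applying the polynomial \<open>\<phi>\<^bsub>l+1\<^esub>\<close> to a finite sum over trees of level \<open>l\<close> yields a sum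
  over finite multisets of such trees: the term of a multiset \<open>ts\<close> is \<open>\<phi>\<^bsub>l+1\<^esub>\<^bsup>(M)\<^esup>(0)\<close>, where
  \<open>M = size ts\<close>, times the product over distinct trees \<open>t\<close> of the \<open>k\<close>-th power of the term of \<open>t\<close>
  divided by \<open>k!\<close>, where \<open>k = count ts t\<close>. These factorials are the ones by which the symmetry
  factor of \<open>Node (l + 1) ts\<close> exceeds the product of those of its children.
\<close>

section \<open>Multinomial and Taylor expansions indexed by multisets\<close>

text \<open>The multinomial theorem divided by \<open>fact n\<close>. A multiset over
  \<open>insert a A\<close> splits into \<open>m\<close> copies of \<open>a\<close> and a multiset
  of size \<open>n - m\<close> over \<open>A\<close>, so the binomial theorem closes the
  induction.\<close>

lemma multinomial_multisets_of_size:
  fixes f :: "'a \<Rightarrow> 'b::field_char_0"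
  assumes "finite A"
  shows "(\<Sum>X\<in>multisets_of_size A n. \<Prod>a\<in>A. f a ^ count X a / fact (count X a))
    = sum f A ^ n / fact n"
  using assms
proof (induction A arbitrary: n rule: finite_induct)
  case empty
  show ?case by (cases n) auto
next
  case (insert a A)
  let ?w = "\<lambda>S X. \<Prod>b\<in>S. f b ^ count X b / fact (count X b)"
  have w: "?w (insert a A) (X + replicate_mset m a) = f a ^ m / fact m * ?w A X"
    if "X \<in> multisets_of_size A (n - m)" for m X
  proof -
    have "count X a = 0"
      using that insert.hyps(2) by (auto simp: multisets_of_size_def count_eq_zero_iff)
    moreover have "?w A (X + replicate_mset m a) = ?w A X"
      using insert.hyps(2) by (intro prod.cong) auto
    ultimately show ?thesis
      using insert.hyps by simp
  qed
  have "(\<Sum>X\<in>multisets_of_size (insert a A) n. ?w (insert a A) X)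
      = (\<Sum>(m, X)\<in>(SIGMA m:{0..n}. multisets_of_size A (n - m)).
          ?w (insert a A) (X + replicate_mset m a))"
    by (subst sum.reindex_bij_betw[OF bij_betw_multisets_of_size_insert[OF insert.hyps(2)], symmetric])
      (simp add: case_prod_unfold)
  also have "\<dots> = (\<Sum>(m, X)\<in>(SIGMA m:{0..n}. multisets_of_size A (n - m)).
      f a ^ m / fact m * ?w A X)"
    by (intro sum.cong refl) (use w in auto)
  also have "\<dots> = (\<Sum>m\<in>{0..n}. \<Sum>X\<in>multisets_of_size A (n - m). f a ^ m / fact m * ?w A X)"
    using insert.hyps(1) by (intro sum.Sigma[symmetric]) (auto intro: finite_multisets_of_size)
  also have "\<dots> = (\<Sum>m\<in>{0..n}. f a ^ m / fact m * (sum f A ^ (n - m) / fact (n - m)))"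
    by (simp only: sum_distrib_left[symmetric] insert.IH)
  \<comment> \<open>Here \<open>1 / (fact m * fact (n - m))\<close> becomes
    \<open>(n choose m) / fact n\<close>.\<close>
  also have "\<dots> = (\<Sum>m\<le>n. of_nat (n choose m) * f a ^ m * sum f A ^ (n - m) / fact n)"
    by (intro sum.cong) (auto simp: binomial_fact field_simps)
  also have "\<dots> = (f a + sum f A) ^ n / fact n"
    by (simp add: binomial_ring sum_divide_distrib)
  finally show ?case
    using insert.hyps by simp
qed

lemma higher_deriv_poly_0:
  fixes p :: "'a::real_normed_field poly"
  shows "(deriv ^^ n) (poly p) 0 = fact n * coeff p n"
proof -
  have "deriv (poly q) = poly (pderiv q)" for q :: "'a poly"
    by (auto intro!: DERIV_imp_deriv poly_DERIV)
  then have "(deriv ^^ n) (poly p) = poly ((pderiv ^^ n) p)"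
    by (induction n) auto
  then show ?thesis
    by (simp add: poly_0_coeff_0 coeff_higher_pderiv pochhammer_fact)
qed

text \<open>Group the multisets by size \<open>n\<close>: the factor \<open>fact n\<close> of the
  derivative at 0 cancels the denominator of the multinomial formula, leaving
  \<open>coeff p n * sum f A ^ n\<close>. The bound \<open>degree p\<close> keeps the index set
  finite, since \<open>sum\<close> is 0 on infinite sets.\<close>

lemma poly_sum_multisets:
  fixes p :: "'b::real_normed_field poly" and f :: "'a \<Rightarrow> 'b"
  assumes "finite A"
  shows "(\<Sum>X | set_mset X \<subseteq> A \<and> size X \<le> degree p. (deriv ^^ size X) (poly p) 0 *
           (\<Prod>a\<in>A. f a ^ count X a / fact (count X a))) = poly p (sum f A)"
proof -
  let ?w = "\<lambda>X. \<Prod>a\<in>A. f a ^ count X a / fact (count X a)"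
  have "{X. set_mset X \<subseteq> A \<and> size X \<le> degree p} = (\<Union>n\<le>degree p. multisets_of_size A n)"
    by (auto simp: multisets_of_size_def)
  then have "(\<Sum>X | set_mset X \<subseteq> A \<and> size X \<le> degree p. (deriv ^^ size X) (poly p) 0 * ?w X)
      = (\<Sum>n\<le>degree p. \<Sum>X\<in>multisets_of_size A n. (deriv ^^ size X) (poly p) 0 * ?w X)"
    by (simp only:, intro sum.UNION_disjoint)
      (auto simp: multisets_of_size_def[of A] intro: finite_multisets_of_size[OF assms, unfolded multisets_of_size_def])
  also have "\<dots> = (\<Sum>n\<le>degree p. \<Sum>X\<in>multisets_of_size A n. fact n * coeff p n * ?w X)"
    by (intro sum.cong refl) (auto simp: multisets_of_size_def higher_deriv_poly_0)
  also have "\<dots> = poly p (sum f A)"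
    by (simp add: sum_distrib_left[symmetric] multinomial_multisets_of_size[OF assms] poly_altdef)
  finally show ?thesis .
qed

section \<open>Scalar weights of trees\<close>

text \<open>
  Weighting every leaf by \<open>g\<close> treats both expansions at once: \<open>g i = x $ i\<close> gives \<open>tree_mono x\<close>
  and \<open>g = (\<lambda>_. 1)\<close> gives the expansion over the trees with leaves \<open>x\<close>.
\<close>

primrec leaf_prod :: "('a \<Rightarrow> real) \<Rightarrow> 'a tree \<Rightarrow> real" where
  "leaf_prod g (Leaf a) = g a"
| "leaf_prod g (Node k ts) = (\<Prod>t\<in>#ts. leaf_prod g t)"

lemma tree_mono_eq_leaf_prod: "tree_mono x t = leaf_prod (($) x) t"
  by (induction t) (auto intro!: arg_cong[of _ _ prod_mset] image_mset_cong)

lemma leaf_prod_one: "leaf_prod (\<lambda>_. 1) t = 1"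
proof (induction t)
  case (Node k ts)
  then have "image_mset (leaf_prod (\<lambda>_. 1)) ts = image_mset (\<lambda>_. 1) ts"
    by (intro image_mset_cong) auto
  then show ?case by simp
qed simp

definition tree_weight :: "(nat \<Rightarrow> real \<Rightarrow> real) \<Rightarrow> ('a \<Rightarrow> real) \<Rightarrow> 'a tree \<Rightarrow> real" where
  "tree_weight \<phi> g t = tree_coeff \<phi> t / real (tree_sym t) * leaf_prod g t"

text \<open>The function \<open>h\<close> will be a component of the vectors of the children.
  Extending the product from \<open>set_mset ts\<close> to \<open>A\<close> only adds factors 1, as
  counts outside \<open>ts\<close> are 0, and gives the summand of the multinomial formula.\<close>

lemma tree_weight_Node:
  fixes h :: "'a tree \<Rightarrow> real"
  assumes "finite A" and "set_mset ts \<subseteq> A"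
  shows "tree_weight \<phi> g (Node k ts) * (\<Prod>t\<in>#ts. h t) = (deriv ^^ size ts) (\<phi> k) 0 *
    (\<Prod>t\<in>A. (tree_weight \<phi> g t * h t) ^ count ts t / fact (count ts t))"
proof -
  have "(\<Prod>t\<in>A. (tree_weight \<phi> g t * h t) ^ count ts t / fact (count ts t))
      = (\<Prod>t\<in>set_mset ts. (tree_weight \<phi> g t * h t) ^ count ts t / fact (count ts t))"
    using assms by (intro prod.mono_neutral_right) (auto simp: not_in_iff)
  also have "\<dots> = (\<Prod>t\<in>set_mset ts. tree_coeff \<phi> t ^ count ts t * leaf_prod g t ^ count ts t
      * h t ^ count ts t / (fact (count ts t) * real (tree_sym t) ^ count ts t))"
    by (intro prod.cong refl) (simp add: tree_weight_def power_mult_distrib power_divide)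
  finally show ?thesis
    by (simp add: tree_weight_def image_prod_mset_multiplicity prod.distrib prod_dividef)
qed

section \<open>Trees with nonzero coefficient\<close>

lemma trees_support_Suc:
  "{t \<in> trees A (Suc l). tree_coeff \<phi> t \<noteq> 0} = Node (Suc l) ` {ts.
      set_mset ts \<subseteq> {t \<in> trees A l. tree_coeff \<phi> t \<noteq> 0} \<and> (deriv ^^ size ts) (\<phi> (Suc l)) 0 \<noteq> 0}"
  by (auto simp: subset_iff)

lemma size_le_degree_if_higher_deriv_nonzero:
  fixes p :: "'a::real_normed_field poly"
  shows "(deriv ^^ n) (poly p) 0 \<noteq> 0 \<Longrightarrow> n \<le> degree p"
  by (auto simp: higher_deriv_poly_0 intro: le_degree)

lemma finite_multisets_of_size_le:
  assumes "finite A"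
  shows "finite {X. set_mset X \<subseteq> A \<and> size X \<le> n}"
proof -
  have "{X. set_mset X \<subseteq> A \<and> size X \<le> n} = (\<Union>m\<le>n. multisets_of_size A m)"
    by (auto simp: multisets_of_size_def)
  then show ?thesis
    using assms by (auto intro: finite_multisets_of_size)
qed

text \<open>Derivatives of order above the degree vanish, so a node with nonzero coefficient has
  boundedly many children, all from the finite support one level below.\<close>

lemma finite_trees_support:
  assumes "finite A" and \<phi>: "\<And>k. k \<ge> 1 \<Longrightarrow> \<exists>p. \<phi> k = poly p"
  shows "finite {t \<in> trees A l. tree_coeff \<phi> t \<noteq> 0}"
proof (induction l)
  case 0
  show ?case using assms(1) by simp
next
  case (Suc l)
  obtain p where p: "\<phi> (Suc l) = poly p" using \<phi>[of "Suc l"] by auto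
  show ?case
    unfolding trees_support_Suc p
    by (intro finite_imageI finite_subset[OF _ finite_multisets_of_size_le[OF Suc.IH, of "degree p"]])
      (auto dest: size_le_degree_if_higher_deriv_nonzero)
qed

text \<open>One activation step, before \<open>W (Suc l)\<close> acts. The value 0 at leaves is a
  dummy: trees of level \<open>Suc l\<close> are nodes.\<close>

lemma sum_trees_support_Suc:
  fixes h :: "'a tree \<Rightarrow> real"
  assumes fin: "finite {t \<in> trees A l. tree_coeff \<phi> t \<noteq> 0}" and p: "\<phi> (Suc l) = poly p"
  shows "(\<Sum>t | t \<in> trees A (Suc l) \<and> tree_coeff \<phi> t \<noteq> 0. tree_weight \<phi> g t *
           (case t of Node k ts \<Rightarrow> \<Prod>u\<in>#ts. h u | Leaf a \<Rightarrow> 0))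
       = \<phi> (Suc l) (\<Sum>t | t \<in> trees A l \<and> tree_coeff \<phi> t \<noteq> 0. tree_weight \<phi> g t * h t)"
    (is "?lhs = _ (sum _ ?F)")
proof -
  let ?T = "\<lambda>ts. (deriv ^^ size ts) (poly p) 0 *
    (\<Prod>t\<in>?F. (tree_weight \<phi> g t * h t) ^ count ts t / fact (count ts t))"
  have "?lhs = (\<Sum>ts | set_mset ts \<subseteq> ?F \<and> (deriv ^^ size ts) (poly p) 0 \<noteq> 0.
      tree_weight \<phi> g (Node (Suc l) ts) * (\<Prod>t\<in>#ts. h t))"
    unfolding trees_support_Suc p by (subst sum.reindex) (auto simp: inj_on_def)
  also have "\<dots> = (\<Sum>ts | set_mset ts \<subseteq> ?F \<and> (deriv ^^ size ts) (poly p) 0 \<noteq> 0. ?T ts)"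
    by (intro sum.cong refl, subst tree_weight_Node[OF fin]) (auto simp: p)
  \<comment> \<open>The multisets added here have a vanishing derivative factor.\<close>
  also have "\<dots> = (\<Sum>ts | set_mset ts \<subseteq> ?F \<and> size ts \<le> degree p. ?T ts)"
    using finite_multisets_of_size_le[OF fin]
    by (intro sum.mono_neutral_left) (auto dest: size_le_degree_if_higher_deriv_nonzero)
  also have "\<dots> = poly p (\<Sum>t\<in>?F. tree_weight \<phi> g t * h t)"
    by (rule poly_sum_multisets[OF fin])
  finally show ?thesis by (simp add: p)
qed

section \<open>Componentwise induction on the level\<close>

lemma tree_vec_carrier:
  assumes "\<And>k. W k \<in> carrier_mat (N (Suc k)) (N k)" and "t \<in> trees A l"
  shows "tree_vec N W e t \<in> carrier_vec (N (Suc l))"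
proof (rule carrier_vecI)
  have "dim_row (W l) = N (Suc l)"
    using assms(1) by (rule carrier_matD(1))
  then show "dim_vec (tree_vec N W e t) = N (Suc l)"
    using assms(2) by (cases l) auto
qed

lemma network_carrier:
  assumes "\<And>k. W k \<in> carrier_mat (N (Suc k)) (N k)"
  shows "network W \<phi> l x \<in> carrier_vec (N (Suc l))"
proof (rule carrier_vecI)
  have "dim_row (W l) = N (Suc l)"
    using assms by (rule carrier_matD(1))
  then show "dim_vec (network W \<phi> l x) = N (Suc l)"
    by (cases l) simp_all
qed

text \<open>The two expansions differ only at level 0, which \<open>base\<close> isolates. The
  component \<open>i\<close> must vary in the induction, because each component of one level uses
  all components of the level below.\<close>

lemma network_index_expansion:
  assumes "finite A"
    and \<phi>: "\<And>k. k \<ge> 1 \<Longrightarrow> \<exists>p. \<phi> k = poly p"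
    and W: "\<And>k. W k \<in> carrier_mat (N (Suc k)) (N k)"
    and base: "\<And>i. i < N 1 \<Longrightarrow> (W 0 *\<^sub>v x) $ i = (\<Sum>a\<in>A. g a * (W 0 *\<^sub>v e a) $ i)"
    and "i < N (Suc l)"
  shows "network W \<phi> l x $ i = (\<Sum>t | t \<in> trees A l \<and> tree_coeff \<phi> t \<noteq> 0.
    tree_weight \<phi> g t * tree_vec N W e t $ i)"
  using \<open>i < N (Suc l)\<close>
proof (induction l arbitrary: i)
  case 0
  have "{t \<in> trees A 0. tree_coeff \<phi> t \<noteq> 0} = Leaf ` A"
    by auto
  then show ?case
    using base 0 by (simp add: sum.reindex inj_on_def tree_weight_def)
next
  case (Suc l)
  let ?F = "\<lambda>l. {t \<in> trees A l. tree_coeff \<phi> t \<noteq> 0}"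
  \<comment> \<open>Component \<open>j\<close> of the entrywise product of the children's
    vectors.\<close>
  let ?child = "\<lambda>j t. case t of Node k ts \<Rightarrow> \<Prod>u\<in>#ts. tree_vec N W e u $ j | Leaf a \<Rightarrow> 0"
  obtain p where p: "\<phi> (Suc l) = poly p" using \<phi>[of "Suc l"] by auto
  have dims: "dim_row (W (Suc l)) = N (Suc (Suc l))" "dim_col (W (Suc l)) = N (Suc l)"
    using W[of "Suc l"] by auto
  have dim: "dim_vec (network W \<phi> l x) = N (Suc l)"
    by (intro carrier_vecD network_carrier W)
  have vec: "tree_vec N W e t $ i = (\<Sum>j<N (Suc l). W (Suc l) $$ (i, j) * ?child j t)"
    if "t \<in> ?F (Suc l)" for t
    using that Suc.prems dims
    by (auto simp: scalar_prod_def hadamard_prod_def multiset.map_comp comp_def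
        simp flip: atLeast0LessThan)
  have "network W \<phi> (Suc l) x $ i
      = (\<Sum>j<N (Suc l). W (Suc l) $$ (i, j) * \<phi> (Suc l) (network W \<phi> l x $ j))"
    using Suc.prems dims dim by (simp add: scalar_prod_def atLeast0LessThan)
  also have "\<dots> = (\<Sum>j<N (Suc l). W (Suc l) $$ (i, j) *
      (\<Sum>t\<in>?F (Suc l). tree_weight \<phi> g t * ?child j t))"
    \<comment> \<open>Used with \<open>h\<close> the component \<open>j\<close> of
      \<open>tree_vec\<close>.\<close>
    using sum_trees_support_Suc[where \<phi> = \<phi> and g = g, OF finite_trees_support[OF \<open>finite A\<close> \<phi>] p]
    by (intro sum.cong refl) (simp add: Suc.IH)
  also have "\<dots> = (\<Sum>j<N (Suc l). \<Sum>t\<in>?F (Suc l).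
      tree_weight \<phi> g t * (W (Suc l) $$ (i, j) * ?child j t))"
    by (simp only: sum_distrib_left mult.left_commute)
  also have "\<dots> = (\<Sum>t\<in>?F (Suc l). tree_weight \<phi> g t *
      (\<Sum>j<N (Suc l). W (Suc l) $$ (i, j) * ?child j t))"
    by (subst sum.swap) (simp only: sum_distrib_left)
  also have "\<dots> = (\<Sum>t\<in>?F (Suc l). tree_weight \<phi> g t * tree_vec N W e t $ i)"
    by (intro sum.cong refl) (simp only: vec)
  finally show ?case .
qed

section \<open>From components to vectors\<close>

text \<open>The set \<open>F\<close> may exceed the support of \<open>f\<close>: a tree with nonzero
  coefficient can still contribute the zero vector, for instance through a zero entry of
  \<open>x\<close>.\<close>

lemma fin_supp_sum_vec_index:
  assumes "finite F" and "F \<subseteq> A" and "\<And>a. a \<in> A \<Longrightarrow> f a \<in> carrier_vec n"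
    and zero: "\<And>a. a \<in> A - F \<Longrightarrow> f a = 0\<^sub>v n"
    and "i < n"
  shows "fin_supp_sum_vec n f A $ i = (\<Sum>a\<in>F. f a $ i)"
proof -
  have sub: "{a \<in> A. f a \<noteq> 0\<^sub>v n} \<subseteq> F"
    using zero by auto
  have "fin_supp_sum_vec n f A $ i = (\<Sum>a | a \<in> A \<and> f a \<noteq> 0\<^sub>v n. f a $ i)"
    unfolding fin_supp_sum_vec_def
    using assms(3,5) finite_subset[OF sub assms(1)] by (intro index_finsum_vec) auto
  also have "\<dots> = (\<Sum>a\<in>F. f a $ i)"
    using sub assms by (intro sum.mono_neutral_left) auto
  finally show ?thesis .
qed

lemma fin_supp_sum_vec_carrier:
  assumes "\<And>a. a \<in> A \<Longrightarrow> f a \<in> carrier_vec n"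
  shows "fin_supp_sum_vec n f A \<in> carrier_vec n"
  unfolding fin_supp_sum_vec_def using assms by (intro finsum_vec_closed) auto

lemma network_expansion:
  assumes "finite A"
    and \<phi>: "\<And>k. k \<ge> 1 \<Longrightarrow> \<exists>p. \<phi> k = poly p"
    and W: "\<And>k. W k \<in> carrier_mat (N (Suc k)) (N k)"
    and base: "\<And>i. i < N 1 \<Longrightarrow> (W 0 *\<^sub>v x) $ i = (\<Sum>a\<in>A. g a * (W 0 *\<^sub>v e a) $ i)"
  shows "network W \<phi> l x =
    fin_supp_sum_vec (N (Suc l)) (\<lambda>t. tree_weight \<phi> g t \<cdot>\<^sub>v tree_vec N W e t) (trees A l)"
    (is "_ = fin_supp_sum_vec ?n ?f _")
proof (rule eq_vecI)
  let ?F = "{t \<in> trees A l. tree_coeff \<phi> t \<noteq> 0}"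
  have carrier: "tree_vec N W e t \<in> carrier_vec ?n" if "t \<in> trees A l" for t
    using tree_vec_carrier[of W N, OF W that] .
  have f: "?f t \<in> carrier_vec ?n" if "t \<in> trees A l" for t
    using carrier[OF that] by simp
  have dim: "dim_vec (fin_supp_sum_vec ?n ?f (trees A l)) = ?n"
    by (intro carrier_vecD fin_supp_sum_vec_carrier f)
  show "dim_vec (network W \<phi> l x) = dim_vec (fin_supp_sum_vec ?n ?f (trees A l))"
    unfolding dim by (intro carrier_vecD network_carrier W)
  fix i assume "i < dim_vec (fin_supp_sum_vec ?n ?f (trees A l))"
  then have i: "i < ?n" by (simp only: dim)
  have zero: "?f t = 0\<^sub>v ?n" if "t \<in> trees A l - ?F" for t
    using that carrier[of t] by (auto simp: tree_weight_def)
  have "fin_supp_sum_vec ?n ?f (trees A l) $ i = (\<Sum>t\<in>?F. ?f t $ i)"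
    by (rule fin_supp_sum_vec_index[OF finite_trees_support[of A \<phi>, OF \<open>finite A\<close> \<phi>] _ f zero i]) auto
  also have "\<dots> = (\<Sum>t\<in>?F. tree_weight \<phi> g t * tree_vec N W e t $ i)"
    using i by (intro sum.cong refl) (auto dest: carrier)
  also have "\<dots> = network W \<phi> l x $ i"
    by (rule network_index_expansion[of A \<phi> W N x g e, OF assms i, symmetric])
  finally show "network W \<phi> l x $ i = fin_supp_sum_vec ?n ?f (trees A l) $ i" by simp
qed

theorem theorem4:
  fixes \<phi> :: "nat \<Rightarrow> real \<Rightarrow> real"
    and N :: "nat \<Rightarrow> nat"
    and W :: "nat \<Rightarrow> real mat"
    and x :: "real vec"
    and l :: nat
  assumes "\<And>k. k \<ge> 1 \<Longrightarrow> \<exists>p. \<phi> k = poly p"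
    and "\<And>k. N k > 0"
    and "\<And>k. W k \<in> carrier_mat (N (Suc k)) (N k)"
    and "x \<in> carrier_vec (N 0)"
  shows "finite {\<tau> \<in> trees {..<N 0} l. tree_coeff \<phi> \<tau> \<noteq> 0}
    \<and> finite {\<eta> \<in> trees {x} l. tree_coeff \<phi> \<eta> \<noteq> 0}
    \<and> network W \<phi> l x \<in> carrier_vec (N (Suc l))
    \<and> network W \<phi> l x =
        fin_supp_sum_vec (N (Suc l))
          (\<lambda>\<tau>. (tree_coeff \<phi> \<tau> / real (tree_sym \<tau>) * tree_mono x \<tau>)
                 \<cdot>\<^sub>v tree_vec N W (unit_vec (N 0)) \<tau>)
          (trees {..<N 0} l)
    \<and> network W \<phi> l x =
        fin_supp_sum_vec (N (Suc l))
          (\<lambda>\<eta>. (tree_coeff \<phi> \<eta> / real (tree_sym \<eta>)) \<cdot>\<^sub>v tree_vec N W (\<lambda>v. v) \<eta>)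
          (trees {x} l)"
proof -
  have dims: "dim_row (W 0) = N 1" "dim_col (W 0) = N 0" "dim_vec x = N 0"
    using assms(3)[of 0] assms(4) by auto
  \<comment> \<open>\<open>base\<close> for basis leaves: \<open>W 0\<close> times \<open>x\<close>
    is the combination of the columns of \<open>W 0\<close> with the entries of \<open>x\<close> as
    coefficients.\<close>
  have "(W 0 *\<^sub>v x) $ i = (\<Sum>j<N 0. x $ j * (W 0 *\<^sub>v unit_vec (N 0) j) $ i)" if "i < N 1" for i
  proof -
    have "(W 0 *\<^sub>v unit_vec (N 0) j) $ i = W 0 $$ (i, j)" if "j < N 0" for j
      using that \<open>i < N 1\<close> dims by (simp add: scalar_prod_right_unit)
    then show ?thesis
      using that dims by (simp add: scalar_prod_def atLeast0LessThan mult.commute)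
  qed
  then have "network W \<phi> l x = fin_supp_sum_vec (N (Suc l))
      (\<lambda>\<tau>. tree_weight \<phi> (($) x) \<tau> \<cdot>\<^sub>v tree_vec N W (unit_vec (N 0)) \<tau>) (trees {..<N 0} l)"
    by (intro network_expansion[where \<phi> = \<phi> and W = W and N = N, OF _ assms(1,3)]) simp_all
  \<comment> \<open>For the single label \<open>x\<close> with leaf weight 1, \<open>base\<close> is
    trivial.\<close>
  moreover have "network W \<phi> l x = fin_supp_sum_vec (N (Suc l))
      (\<lambda>\<eta>. tree_weight \<phi> (\<lambda>_. 1) \<eta> \<cdot>\<^sub>v tree_vec N W (\<lambda>v. v) \<eta>) (trees {x} l)"
    by (intro network_expansion[where \<phi> = \<phi> and W = W and N = N, OF _ assms(1,3)]) simp_all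
  moreover have "finite {\<tau> \<in> trees {..<N 0} l. tree_coeff \<phi> \<tau> \<noteq> 0}"
      "finite {\<eta> \<in> trees {x} l. tree_coeff \<phi> \<eta> \<noteq> 0}"
    by (intro finite_trees_support[where \<phi> = \<phi>, OF _ assms(1)]; simp)+
  moreover have "network W \<phi> l x \<in> carrier_vec (N (Suc l))"
    by (intro network_carrier assms(3))
  ultimately show ?thesis
    by (simp add: tree_weight_def tree_mono_eq_leaf_prod leaf_prod_one)
qed

end
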